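(* Let $d\in\{\triangle,\delta\}$, let $m,n,n_1,n_2\ge 1$ be integers, and let $S,T\in B(\mathcal H)$ satisfy $S^{*n}\,d^m_{T,S}(I)\,S^n=0$. Let $N_1,N_2\in B(\mathcal H)$ be such that $N_i^{n_i}=0$ ($i=1,2$), $SN_1=N_1S$, $ST^*=T^*S$, $N_2T=TN_2$ and $N_2^*S=SN_2^*$. Then $$(S^*+N_1^* )^{n+n_1-1}\,d^{\,m+n_1+n_2-2}_{T+N_2,\,S+N_1}(I)\,(S+N_1)^{n+n_1-1}=0 .$$
   Context: $\mathcal H$ is a complex infinite dimensional Hilbert space. For $T,S\in B(\mathcal H)$, $\triangle^m_{T,S}(I)=\sum_{j=0}^m(-1)^j\binom mj T^{m-j}S^{m-j}$ and $\delta^m_{T,S}(I)=\sum_{j=0}^m(-1)^j\binom mj T^{m-j}S^{j}$; $d$ denotes either $\triangle$ or $\delta$ (the same choice throughout). *)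

theory Defs
  imports "HOL-Analysis.Analysis"
begin

text \<open>Complex inner product spaces, with the inner product linear in the first argument. The
  metric, topology and real scalar multiplication are those of the library's real normed spaces,
  tied to the complex structure by \<open>scaleR_scaleC\<close> and \<open>norm_eq_sqrt_cinner\<close>.\<close>

class complex_inner = real_normed_vector +
  fixes scaleC :: "complex \<Rightarrow> 'a \<Rightarrow> 'a" (infixr \<open>*\<^sub>C\<close> 75)
    and cinner :: "'a \<Rightarrow> 'a \<Rightarrow> complex"
  assumes scaleC_add_right: "a *\<^sub>C (x + y) = a *\<^sub>C x + a *\<^sub>C y"
    and scaleC_add_left: "(a + b) *\<^sub>C x = a *\<^sub>C x + b *\<^sub>C x"
    and scaleC_scaleC: "a *\<^sub>C b *\<^sub>C x = (a * b) *\<^sub>C x"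
    and scaleR_scaleC: "r *\<^sub>R x = complex_of_real r *\<^sub>C x"
    and cinner_commute: "cinner x y = cnj (cinner y x)"
    and cinner_add_left: "cinner (x + y) z = cinner x z + cinner y z"
    and cinner_scaleC_left: "cinner (a *\<^sub>C x) y = a * cinner x y"
    and cinner_ge_zero: "0 \<le> Re (cinner x x)"
    and cinner_eq_zero_iff: "cinner x x = 0 \<longleftrightarrow> x = 0"
    and norm_eq_sqrt_cinner: "norm x = sqrt (Re (cinner x x))"

class chilbert_space = complex_inner + complete_space

global_interpretation complex_vector:
  vector_space "scaleC :: complex \<Rightarrow> 'a \<Rightarrow> 'a::complex_inner"
proof
  fix x :: 'a
  show "1 *\<^sub>C x = x"
    using scaleR_scaleC[of 1 x] by simp
qed (simp_all add: scaleC_add_right scaleC_add_left scaleC_scaleC)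

definition bounded_clinear :: "('a::complex_inner \<Rightarrow> 'b::complex_inner) \<Rightarrow> bool" where
  "bounded_clinear f \<longleftrightarrow> bounded_linear f \<and> (\<forall>c x. f (c *\<^sub>C x) = c *\<^sub>C f x)"

text \<open>For bounded \<open>A\<close> on a Hilbert space, such a \<open>B\<close> exists by the Riesz representation theorem;
  uniqueness is immediate.\<close>

definition cadjoint :: "('a::chilbert_space \<Rightarrow> 'a) \<Rightarrow> 'a \<Rightarrow> 'a" where
  "cadjoint A = (THE B. \<forall>x y. cinner (A x) y = cinner x (B y))"

text \<open>\<open>triangle_op m T S\<close> and \<open>delta_op m T S\<close> are the operators \<open>\<triangle>\<^sup>m\<^bsub>T,S\<^esub>(I)\<close> and \<open>\<delta>\<^sup>m\<^bsub>T,S\<^esub>(I)\<close>,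
  already evaluated at the identity.\<close>

definition triangle_op :: "nat \<Rightarrow> ('a::complex_inner \<Rightarrow> 'a) \<Rightarrow> ('a \<Rightarrow> 'a) \<Rightarrow> 'a \<Rightarrow> 'a" where
  "triangle_op m T S =
    (\<lambda>x. \<Sum>j=0..m. ((-1) ^ j * of_nat (m choose j)) *\<^sub>C ((T ^^ (m - j)) \<circ> (S ^^ (m - j))) x)"

definition delta_op :: "nat \<Rightarrow> ('a::complex_inner \<Rightarrow> 'a) \<Rightarrow> ('a \<Rightarrow> 'a) \<Rightarrow> 'a \<Rightarrow> 'a" where
  "delta_op m T S =
    (\<lambda>x. \<Sum>j=0..m. ((-1) ^ j * of_nat (m choose j)) *\<^sub>C ((T ^^ (m - j)) \<circ> (S ^^ j)) x)"

end

theory Submission imports Defs begin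

text \<open>
  Both \<open>d\<^sup>m\<^bsub>T,S\<^esub>(I)\<close> are values \<open>\<phi>\<^sup>m(I)\<close> of powers of a superoperator, where \<open>\<phi>(X) = T X S - X\<close> for
  \<open>\<triangle>\<close> and \<open>\<phi>(X) = T X - X S\<close> for \<open>\<delta>\<close>: since left and right multiplications commute with each
  other, the binomial sum in the definition is just the expansion of that power
  (\<open>triangle_op_eq_power\<close>, \<open>delta_op_eq_power\<close>). Replacing \<open>T\<close> and \<open>S\<close> by \<open>T + N\<^sub>2\<close> and \<open>S + N\<^sub>1\<close>
  changes \<open>\<phi>\<close> into \<open>\<phi> + \<alpha> + \<beta>\<close>, with \<open>\<alpha>\<close> and \<open>\<beta>\<close> commuting with \<open>\<phi>\<close> and with each other;
  \<open>\<alpha>\<close> has a right factor \<open>N\<^sub>1\<close> and \<open>\<beta>\<close> a left factor \<open>N\<^sub>2\<close>, so their powers of exponents \<open>n\<^sub>1\<close> and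
  \<open>n\<^sub>2\<close> vanish.

  The purely ring-theoretic fact behind the exponents is \<open>nilpotent_perturbation_power\<close>: if \<open>g\<close>
  commutes with \<open>f\<close> and \<open>g\<^sup>k = 0\<close>, then \<open>(f + g)\<^bsup>n+k-1\<^esup>\<close> is a multiple of \<open>f\<^sup>n\<close>. It is applied to
  four sums. Twice among superoperators, it makes \<open>(\<phi> + \<alpha> + \<beta>)\<^bsup>m+n\<^sub>1+n\<^sub>2-2\<^esup>\<close> equal to \<open>\<omega> \<phi>\<^sup>m\<close>.
  Among operators, it makes the outer factors \<open>(S\<^sup>* + N\<^sub>1\<^sup>*)\<^bsup>n+n\<^sub>1-1\<^esup>\<close> and
  \<open>(S + N\<^sub>1)\<^bsup>n+n\<^sub>1-1\<^esup>\<close> equal to \<open>W' S\<^sup>*\<^sup>n\<close> and \<open>S\<^sup>n W\<close>. What is left to see is that the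
  compression \<open>\<gamma>(X) = S\<^sup>*\<^sup>n X S\<^sup>n\<close> kills \<open>\<omega>(\<phi>\<^sup>m(I))\<close>. By hypothesis it kills \<open>\<phi>\<^sup>m(I)\<close>; and it
  commutes with \<open>\<omega>\<close>, because \<open>\<omega>\<close> is a polynomial in \<open>\<phi>\<close>, \<open>\<alpha>\<close>, \<open>\<beta>\<close>, while \<open>S\<close> commutes with
  \<open>N\<^sub>1\<close> and the adjoints of the remaining hypotheses make \<open>S\<^sup>*\<close> commute with \<open>T\<close> and \<open>N\<^sub>2\<close>.
  This is \<open>compressed_perturbation_eq_0\<close>.

  Operators are treated as elements of the ring of additive endomorphisms of the space, and
  superoperators as elements of the ring of additive endomorphisms of that ring, so the one ring
  lemma serves on both levels. Analysis enters only through the existence of adjoints.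
\<close>

section \<open>Adjoints on a complex Hilbert space\<close>

lemma cinner_add_right: "cinner x (y + z) = cinner x y + cinner x z"
  for x :: "'a::complex_inner"
  by (metis cinner_add_left cinner_commute complex_cnj_add)

lemma cinner_zero_left [simp]: "cinner 0 x = 0" for x :: "'a::complex_inner"
  using cinner_add_left[of 0 0 x] by simp

lemma cinner_zero_right [simp]: "cinner x 0 = 0" for x :: "'a::complex_inner"
  using cinner_add_right[of x 0 0] by simp

lemma cinner_minus_right: "cinner x (- y) = - cinner x y" for x :: "'a::complex_inner"
  using cinner_add_right[of x y "- y"] by (simp add: eq_neg_iff_add_eq_0 add.commute)

lemma cinner_diff_right: "cinner x (y - z) = cinner x y - cinner x z"
  for x :: "'a::complex_inner"
  using cinner_add_right[of x y "- z"] by (simp add: cinner_minus_right)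

lemma cinner_scaleR_left: "cinner (r *\<^sub>R x) y = r *\<^sub>R cinner x y"
  for x :: "'a::complex_inner"
  by (simp add: scaleR_scaleC[where 'a='a] cinner_scaleC_left scaleR_conv_of_real)

lemma Re_cinner_commute: "Re (cinner x y) = Re (cinner y x)" for x :: "'a::complex_inner"
  by (subst cinner_commute) simp

lemma norm_square_eq_cinner: "(norm x)\<^sup>2 = Re (cinner x x)" for x :: "'a::complex_inner"
  by (simp add: norm_eq_sqrt_cinner cinner_ge_zero)

lemma norm_add_square: "(norm (x + y))\<^sup>2 = (norm x)\<^sup>2 + 2 * Re (cinner x y) + (norm y)\<^sup>2"
  for x :: "'a::complex_inner"
  using Re_cinner_commute[of x y]
  by (simp add: norm_square_eq_cinner cinner_add_left cinner_add_right)

lemma parallelogram_law: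
  "(norm (x + y))\<^sup>2 + (norm (x - y))\<^sup>2 = 2 * (norm x)\<^sup>2 + 2 * (norm y)\<^sup>2"
  for x :: "'a::complex_inner"
  using norm_add_square[of x y] norm_add_square[of x "- y"] by (simp add: cinner_minus_right)

text \<open>Expanding the squared triangle inequality already gives the Cauchy-Schwarz estimate for the
  real part.\<close>

lemma abs_Re_cinner_le: "\<bar>Re (cinner x y)\<bar> \<le> norm x * norm y" for x :: "'a::complex_inner"
proof -
  have upper: "Re (cinner x z) \<le> norm x * norm z" for z
  proof -
    have "(norm (x + z))\<^sup>2 \<le> (norm x + norm z)\<^sup>2"
      by (intro power_mono norm_triangle_ineq) simp
    then show ?thesis
      unfolding norm_add_square by (simp add: power2_sum)
  qed
  show ?thesis
    using upper[of y] upper[of "- y"] by (simp add: cinner_minus_right)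
qed

text \<open>The representing vector is the minimiser of \<open>\<parallel>x\<parallel>\<^sup>2 - 2 g x\<close>, since the derivative of this
  function at \<open>v\<close> in direction \<open>h\<close> is twice the difference of the two sides at \<open>h\<close>. By the
  parallelogram law every minimising sequence is Cauchy, so completeness provides the minimiser.\<close>

lemma Riesz_representation_real:
  fixes g :: "'a::chilbert_space \<Rightarrow> real"
  assumes "bounded_linear g"
  shows "\<exists>v. \<forall>h. g h = Re (cinner h v)"
proof -
  interpret g: bounded_linear g by fact
  define q where "q x = (norm x)\<^sup>2 - 2 * g x" for x
  obtain K where K: "\<And>x. norm (g x) \<le> norm x * K"
    using g.bounded by blast
  have "- K\<^sup>2 \<le> q x" for x
  proof -
    have "g x \<le> norm x * K" using K[of x] by simp
    moreover have "0 \<le> (norm x - K)\<^sup>2" by simp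
    ultimately show ?thesis by (simp add: q_def power2_diff)
  qed
  then have bdd: "bdd_below (range q)" by (intro bdd_belowI) auto
  define I where "I = Inf (range q)"
  have I_le: "I \<le> q x" for x
    unfolding I_def using bdd by (intro cInf_lower) auto
  have "\<exists>x. q x < I + inverse (real (Suc k))" for k
    using cInf_lessD[of "range q" "I + inverse (real (Suc k))"] by (auto simp: I_def)
  then obtain X where X: "\<And>k. q (X k) < I + inverse (real (Suc k))" by metis
  have dist: "(norm (x - y))\<^sup>2 \<le> 2 * (q x - I) + 2 * (q y - I)" for x y
  proof -
    have "q ((1/2) *\<^sub>R (x + y)) = (norm (x + y))\<^sup>2 / 4 - (g x + g y)"
      unfolding q_def g.scaleR g.add norm_scaleR
      by (simp only: power_mult_distrib real_scaleR_def) (simp add: power2_eq_square algebra_simps)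
    then show ?thesis
      using I_le[of "(1/2) *\<^sub>R (x + y)"] parallelogram_law[of x y]
      by (simp add: q_def)
  qed
  have "Cauchy X"
  proof (rule metric_CauchyI)
    fix e :: real assume "0 < e"
    then obtain N where N: "inverse (real (Suc N)) < e\<^sup>2 / 4"
      using reals_Archimedean[of "e\<^sup>2 / 4"] by auto
    have close: "q (X k) - I < e\<^sup>2 / 4" if "k \<ge> N" for k
    proof -
      have "inverse (real (Suc k)) \<le> inverse (real (Suc N))"
        using that by (intro le_imp_inverse_le) auto
      then show ?thesis using X[of k] N by linarith
    qed
    have "dist (X i) (X j) < e" if "i \<ge> N" "j \<ge> N" for i j
    proof -
      have "(norm (X i - X j))\<^sup>2 < e\<^sup>2"
        using add_strict_mono[OF close[OF that(1)] close[OF that(2)]]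
        by (intro le_less_trans[OF dist]) simp
      then show ?thesis
        using \<open>0 < e\<close> by (simp add: dist_norm power_less_imp_less_base)
    qed
    then show "\<exists>N. \<forall>i\<ge>N. \<forall>j\<ge>N. dist (X i) (X j) < e" by blast
  qed
  then obtain v where v: "X \<longlonglongrightarrow> v"
    using Cauchy_convergent convergent_def by blast
  have "(\<lambda>k. q (X k)) \<longlonglongrightarrow> q v"
    unfolding q_def by (intro tendsto_intros g.tendsto v)
  moreover have "(\<lambda>k. I + inverse (real (Suc k))) \<longlonglongrightarrow> I + 0"
    by (intro tendsto_add tendsto_const LIMSEQ_inverse_real_of_nat)
  ultimately have "q v \<le> I + 0"
    by (rule LIMSEQ_le) (use X less_imp_le in blast)
  then have minimal: "q v \<le> q x" for x
    using I_le[of x] by simp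
  have "g h = Re (cinner h v)" for h
  proof -
    define a where "a = Re (cinner h v) - g h"
    \<comment> \<open>Minimality on the line through \<open>v\<close> in direction \<open>h\<close> gives a nonnegative quadratic in \<open>t\<close>
      that vanishes at \<open>0\<close>, so its linear coefficient has to vanish.\<close>
    have quad: "0 \<le> 2 * (t * a) + t\<^sup>2 * (norm h)\<^sup>2" for t
      using minimal[of "t *\<^sub>R h + v"] Re_cinner_commute[of v "t *\<^sub>R h"]
      by (simp add: q_def a_def norm_add_square cinner_scaleR_left g.add g.scaleR
          power_mult_distrib algebra_simps)
    \<comment> \<open>Adding 1 keeps the denominator of the test point \<open>t = - a / b\<close> positive when \<open>h = 0\<close>.\<close>
    define b where "b = (norm h)\<^sup>2 + 1"
    have b: "b > 0" "(norm h)\<^sup>2 \<le> b" by (simp_all add: b_def add_nonneg_pos)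
    have "0 \<le> 2 * (- a / b * a) + (- a / b)\<^sup>2 * (norm h)\<^sup>2" by (rule quad)
    also have "\<dots> \<le> 2 * (- a / b * a) + (- a / b)\<^sup>2 * b"
      using b by (intro add_left_mono mult_left_mono) auto
    also have "\<dots> = - (a\<^sup>2 / b)"
      using b by (simp add: field_simps power2_eq_square)
    finally have "a\<^sup>2 \<le> 0"
      using b by (simp add: divide_le_0_iff)
    then show ?thesis by (simp add: a_def)
  qed
  then show ?thesis by blast
qed

text \<open>The algebra of adjoints needs only the defining identity and uniqueness. Keeping it a relation
  separates it from the existence question, and makes the symmetry \<open>T\<^sup>*\<^sup>* = T\<close> available
  directly.\<close>

definition adjoint_pair :: "('a::complex_inner \<Rightarrow> 'a) \<Rightarrow> ('a \<Rightarrow> 'a) \<Rightarrow> bool" where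
  "adjoint_pair A B \<longleftrightarrow> (\<forall>x y. cinner (A x) y = cinner x (B y))"

lemma adjoint_pairD: "adjoint_pair A B \<Longrightarrow> cinner (A x) y = cinner x (B y)"
  by (simp add: adjoint_pair_def)

lemma cinner_right_cancel:
  fixes y z :: "'a::complex_inner"
  assumes "\<And>x. cinner x y = cinner x z"
  shows "y = z"
proof -
  have "cinner (y - z) (y - z) = 0"
    using assms[of "y - z"] by (simp add: cinner_diff_right)
  then show ?thesis by (simp add: cinner_eq_zero_iff)
qed

lemma adjoint_pair_unique:
  assumes "adjoint_pair A B" "adjoint_pair A C"
  shows "B = C"
proof
  fix y show "B y = C y"
    by (rule cinner_right_cancel) (metis adjoint_pairD assms)
qed

lemma adjoint_pair_commute:
  assumes "adjoint_pair A B" shows "adjoint_pair B A"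
  unfolding adjoint_pair_def by (metis adjoint_pairD assms cinner_commute)

lemma adjoint_pair_comp:
  assumes "adjoint_pair A B" "adjoint_pair C D"
  shows "adjoint_pair (A \<circ> C) (D \<circ> B)"
  using assms by (simp add: adjoint_pair_def)

lemma adjoint_pair_funpow:
  assumes "adjoint_pair A B" shows "adjoint_pair (A ^^ k) (B ^^ k)"
proof (induction k)
  case 0 show ?case by (simp add: adjoint_pair_def)
next
  case (Suc k)
  show ?case
    using adjoint_pair_comp[OF assms Suc]
    by (simp only: funpow.simps(2)[of k A] funpow_Suc_right[of k B])
qed

lemma adjoint_pair_zero: "adjoint_pair (\<lambda>x. 0) (\<lambda>x. 0)"
  by (simp add: adjoint_pair_def)

lemma adjoint_pair_nilpotent:
  assumes "adjoint_pair A B" "A ^^ k = (\<lambda>x. 0)"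
  shows "B ^^ k = (\<lambda>x. 0)"
  using adjoint_pair_unique[of "A ^^ k"] adjoint_pair_funpow[OF assms(1), of k]
    adjoint_pair_zero assms(2) by metis

lemma adjoint_pair_commuting:
  assumes "adjoint_pair A B" "adjoint_pair C D" "A \<circ> C = C \<circ> A"
  shows "B \<circ> D = D \<circ> B"
  by (metis adjoint_pair_comp adjoint_pair_unique assms)

lemma adjoint_pair_additive:
  assumes "adjoint_pair A B" shows "Modules.additive B"
proof
  fix x y show "B (x + y) = B x + B y"
    by (rule cinner_right_cancel)
      (simp add: cinner_add_right flip: adjoint_pairD[OF assms])
qed

text \<open>Riesz applied to the real part of \<open>x \<mapsto> \<langle>A x, y\<rangle>\<close> suffices: a complex-linear functional is
  determined by its real part, its imaginary part at \<open>x\<close> being minus the real part at \<open>\<i> x\<close>.\<close>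

lemma adjoint_pair_exists:
  fixes A :: "'a::chilbert_space \<Rightarrow> 'a"
  assumes "bounded_clinear A"
  shows "\<exists>B. adjoint_pair A B"
proof -
  interpret A: bounded_linear A
    using assms by (simp add: bounded_clinear_def)
  have A_scaleC: "A (c *\<^sub>C x) = c *\<^sub>C A x" for c x
    using assms by (simp add: bounded_clinear_def)
  have "\<exists>v. \<forall>x. cinner (A x) y = cinner x v" for y
  proof -
    have "bounded_linear (\<lambda>x. Re (cinner (A x) y))"
    proof -
      obtain K where K: "\<And>x. norm (A x) \<le> norm x * K"
        using A.bounded by blast
      show ?thesis
      proof (rule bounded_linear_intro)
        show "norm (Re (cinner (A x) y)) \<le> norm x * (K * norm y)" for x
        proof -
          have "\<bar>Re (cinner (A x) y)\<bar> \<le> norm (A x) * norm y" by (rule abs_Re_cinner_le)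
          also have "\<dots> \<le> norm x * K * norm y" using K by (simp add: mult_right_mono)
          finally show ?thesis by (simp add: mult.assoc)
        qed
      qed (simp_all add: A.add A.scaleR cinner_add_left cinner_scaleR_left)
    qed
    then obtain v where v: "\<And>x. Re (cinner (A x) y) = Re (cinner x v)"
      using Riesz_representation_real by metis
    have "cinner (A x) y = cinner x v" for x
      using v[of x] v[of "\<i> *\<^sub>C x"] by (simp add: complex_eq_iff A_scaleC cinner_scaleC_left)
    then show ?thesis by blast
  qed
  then obtain B where "\<And>x y. cinner (A x) y = cinner x (B y)" by metis
  then show ?thesis unfolding adjoint_pair_def by blast
qed

lemma adjoint_pair_cadjoint:
  assumes "bounded_clinear A" shows "adjoint_pair A (cadjoint A)"
proof -
  obtain B where B: "adjoint_pair A B" using adjoint_pair_exists[OF assms] by blast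
  have "cadjoint A = (THE B. adjoint_pair A B)"
    by (simp add: cadjoint_def adjoint_pair_def)
  also have "\<dots> = B" using B adjoint_pair_unique by blast
  finally show ?thesis using B by simp
qed

section \<open>Nilpotent perturbations in a ring\<close>

text \<open>The sort is a ring with unit in which \<open>0 = 1\<close> is permitted, because the endomorphism ring of
  a trivial group is the zero ring.\<close>

definition bicommutant :: "'r::{ring,monoid_mult} \<Rightarrow> 'r \<Rightarrow> 'r set" where
  "bicommutant f g = {w. \<forall>h. h * f = f * h \<longrightarrow> h * g = g * h \<longrightarrow> h * w = w * h}"

lemma bicommutantD:
  "w \<in> bicommutant f g \<Longrightarrow> h * f = f * h \<Longrightarrow> h * g = g * h \<Longrightarrow> h * w = w * h"
  by (simp add: bicommutant_def)

lemma bicommutant_closed: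
  "0 \<in> bicommutant f g"
  "f \<in> bicommutant f g"
  "g \<in> bicommutant f g"
  "v \<in> bicommutant f g \<Longrightarrow> w \<in> bicommutant f g \<Longrightarrow> v + w \<in> bicommutant f g"
  "v \<in> bicommutant f g \<Longrightarrow> w \<in> bicommutant f g \<Longrightarrow> v * w \<in> bicommutant f g"
  "w \<in> bicommutant f g \<Longrightarrow> w ^ k \<in> bicommutant f g"
proof -
  show mult: "v * w \<in> bicommutant f g" if "v \<in> bicommutant f g" "w \<in> bicommutant f g" for v w
    using that unfolding bicommutant_def mem_Collect_eq by (metis mult.assoc)
  show "v + w \<in> bicommutant f g" if "v \<in> bicommutant f g" "w \<in> bicommutant f g"
    using that by (simp add: bicommutant_def distrib_left distrib_right)
  show "w ^ k \<in> bicommutant f g" if "w \<in> bicommutant f g"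
    by (induction k) (use that mult in \<open>simp_all add: bicommutant_def\<close>)
qed (simp_all add: bicommutant_def)

lemma nilpotent_power_eq_0:
  fixes g :: "'r::{ring,monoid_mult}"
  assumes "g ^ k = 0" "k \<le> j" shows "g ^ j = 0"
  using assms by (metis le_add_diff_inverse mult_zero_left power_add)

text \<open>In the binomial expansion of \<open>(f + g) ^ p\<close> each monomial \<open>f ^ i * g ^ j\<close> has
  \<open>i + j = p \<ge> n + k - 1\<close>, hence \<open>i \<ge> n\<close> or \<open>j \<ge> k\<close>, so \<open>f ^ n\<close> factors out of everything that does not vanish. The cofactor is a polynomial
  in \<open>f\<close> and \<open>g\<close>; all that matters about it is that it commutes with whatever commutes with
  both.\<close>

lemma nilpotent_perturbation_power:
  fixes f g :: "'r::{ring,monoid_mult}"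
  assumes comm: "f * g = g * f" and nil: "g ^ k = 0" and le: "n + k \<le> Suc p"
  shows "\<exists>w \<in> bicommutant f g. (f + g) ^ p = w * f ^ n"
proof -
  \<comment> \<open>Carrying along a monomial lets the induction produce the expansion without binomial
    coefficients.\<close>
  have "n + k \<le> Suc (r + i + j) \<Longrightarrow>
      \<exists>w \<in> bicommutant f g. (f + g) ^ r * (f ^ i * g ^ j) = w * f ^ n" for r i j
  proof (induction r arbitrary: i j)
    case 0
    show ?case
    proof (cases "k \<le> j")
      case True
      then have "(f + g) ^ 0 * (f ^ i * g ^ j) = 0 * f ^ n"
        by (simp add: nilpotent_power_eq_0[OF nil])
      then show ?thesis using bicommutant_closed(1) by blast
    next
      case False
      then have i: "i = (i - n) + n" using 0 by simp
      have "g ^ j * f ^ n = f ^ n * g ^ j"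
        by (intro power_commuting_commutes) (metis comm power_commuting_commutes)
      then have "(f + g) ^ 0 * (f ^ i * g ^ j) = (f ^ (i - n) * g ^ j) * f ^ n"
        by (subst i) (simp add: power_add mult.assoc)
      then show ?thesis using bicommutant_closed by blast
    qed
  next
    case (Suc r)
    obtain v where v: "v \<in> bicommutant f g" "(f + g) ^ r * (f ^ Suc i * g ^ j) = v * f ^ n"
      using Suc.IH[of "Suc i" j] Suc.prems by auto
    obtain w where w: "w \<in> bicommutant f g" "(f + g) ^ r * (f ^ i * g ^ Suc j) = w * f ^ n"
      using Suc.IH[of i "Suc j"] Suc.prems by auto
    have "g * f ^ i = f ^ i * g"
      using power_commuting_commutes[OF comm] by simp
    then have "g * (f ^ i * g ^ j) = f ^ i * g ^ Suc j"
      by (simp flip: mult.assoc)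
    then have "(f + g) * (f ^ i * g ^ j) = f ^ Suc i * g ^ j + f ^ i * g ^ Suc j"
      by (simp only: distrib_right power_Suc mult.assoc)
    moreover have "(f + g) ^ Suc r * (f ^ i * g ^ j) = (f + g) ^ r * ((f + g) * (f ^ i * g ^ j))"
      by (simp only: power_Suc2 mult.assoc)
    ultimately have "(f + g) ^ Suc r * (f ^ i * g ^ j) =
        (f + g) ^ r * (f ^ Suc i * g ^ j) + (f + g) ^ r * (f ^ i * g ^ Suc j)"
      by (simp only: distrib_left)
    then have "(f + g) ^ Suc r * (f ^ i * g ^ j) = (v + w) * f ^ n"
      by (simp only: v(2) w(2) distrib_right)
    then show ?case using v(1) w(1) bicommutant_closed(4) by blast
  qed
  from this[of p 0 0] le show ?thesis by simp
qed

section \<open>The ring of additive endomorphisms\<close>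

typedef (overloaded) 'v endo = "{f :: 'v::ab_group_add \<Rightarrow> 'v. Modules.additive f}"
  morphisms app Endo
  by (rule exI[of _ "\<lambda>x. 0"]) (simp add: Modules.additive_def)

setup_lifting type_definition_endo

instantiation endo :: (ab_group_add) "{ring,monoid_mult}"
begin
lift_definition zero_endo :: "'a endo" is "\<lambda>x. 0" by (simp add: Modules.additive_def)
lift_definition one_endo :: "'a endo" is "\<lambda>x. x" by (simp add: Modules.additive_def)
lift_definition plus_endo :: "'a endo \<Rightarrow> 'a endo \<Rightarrow> 'a endo" is "\<lambda>f g x. f x + g x"
  by (simp add: Modules.additive_def algebra_simps)
lift_definition minus_endo :: "'a endo \<Rightarrow> 'a endo \<Rightarrow> 'a endo" is "\<lambda>f g x. f x - g x"
  by (simp add: Modules.additive_def algebra_simps)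
lift_definition uminus_endo :: "'a endo \<Rightarrow> 'a endo" is "\<lambda>f x. - f x"
  by (simp add: Modules.additive_def)
lift_definition times_endo :: "'a endo \<Rightarrow> 'a endo \<Rightarrow> 'a endo" is "\<lambda>f g. f \<circ> g"
  by (simp add: Modules.additive_def)
instance
proof
  fix a b c :: "'a endo"
  show "a * b * c = a * (b * c)" by transfer (simp add: comp_assoc)
  show "1 * a = a" by transfer (simp add: fun_eq_iff)
  show "a * 1 = a" by transfer (simp add: fun_eq_iff)
  show "(a + b) * c = a * c + b * c" by transfer (simp add: fun_eq_iff)
  show "a * (b + c) = a * b + a * c" by transfer (simp add: fun_eq_iff Modules.additive_def)
  show "a + b + c = a + (b + c)" by transfer (simp add: add.assoc)
  show "a + b = b + a" by transfer (rule ext, rule add.commute)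
  show "0 + a = a" by transfer simp
  show "- a + a = 0" by transfer simp
  show "a - b = a + - b" by transfer simp
qed
end

lemma app_add: "app f (x + y) = app f x + app f y"
  by transfer (simp add: Modules.additive_def)

lemma app_zero [simp]: "app f 0 = 0"
  using app_add[of f 0 0] by simp

lemma app_power: "app (f ^ k) = app f ^^ k"
  by (induction k) (simp_all add: one_endo.rep_eq times_endo.rep_eq id_def fun_eq_iff)

lift_definition lmult :: "'r::ring \<Rightarrow> 'r endo" is "\<lambda>a x. a * x"
  by (simp add: Modules.additive_def distrib_left)

lift_definition rmult :: "'r::ring \<Rightarrow> 'r endo" is "\<lambda>a x. x * a"
  by (simp add: Modules.additive_def distrib_right)

lemma lmult_rmult_commute: "rmult b * lmult a = lmult a * rmult b"
  by transfer (auto simp: mult.assoc)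

lemma lmult_mult: "lmult a * lmult b = lmult (a * b)"
  by transfer (auto simp: mult.assoc)

lemma rmult_mult: "rmult a * rmult b = rmult (b * a)"
  by transfer (auto simp: mult.assoc)

lemma lmult_add: "lmult (a + b) = lmult a + lmult b"
  by transfer (auto simp: distrib_right)

lemma rmult_add: "rmult (a + b) = rmult a + rmult b"
  by transfer (auto simp: distrib_left)

lemma rmult_uminus: "rmult (- a) = - rmult a"
  by transfer auto

lemma lmult_0 [simp]: "lmult 0 = 0"
  by transfer auto

lemma rmult_0 [simp]: "rmult 0 = 0"
  by transfer auto

lemma two_sided_mult:
  "(lmult a * rmult b) * (lmult c * rmult d) = lmult (a * c) * rmult (d * b)"
proof -
  have "(lmult a * rmult b) * (lmult c * rmult d) = lmult a * (rmult b * lmult c) * rmult d"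
    by (simp only: mult.assoc)
  also have "\<dots> = (lmult a * lmult c) * (rmult b * rmult d)"
    by (simp only: lmult_rmult_commute mult.assoc)
  finally show ?thesis by (simp only: lmult_mult rmult_mult)
qed

lemma lmult_1 [simp]: "lmult (1 :: 'r::{ring,monoid_mult}) = 1"
  by transfer auto

lemma rmult_1 [simp]: "rmult (1 :: 'r::{ring,monoid_mult}) = 1"
  by transfer auto

lemma two_sided_power: "(lmult a * rmult b) ^ k = lmult (a ^ k) * rmult (b ^ k)"
  for a b :: "'r::{ring,monoid_mult}"
  by (induction k) (simp_all add: two_sided_mult power_commutes)

lemma lmult_power: "lmult a ^ k = lmult (a ^ k)" for a :: "'r::{ring,monoid_mult}"
  using two_sided_power[of a 1 k] by simp

lemma rmult_power: "rmult b ^ k = rmult (b ^ k)" for b :: "'r::{ring,monoid_mult}"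
  using two_sided_power[of 1 b k] by simp

section \<open>Perturbing a superoperator\<close>

lemma uminus_power_eq_0:
  fixes a :: "'r::{ring,monoid_mult}"
  assumes "a ^ k = 0" shows "(- a) ^ k = 0"
proof -
  have "(- a) ^ j = a ^ j \<or> (- a) ^ j = - (a ^ j)" for j
    by (induction j) auto
  then show ?thesis using assms by (metis minus_zero)
qed

text \<open>The two perturbations are absorbed one after the other: first \<open>b\<close> is split off
  \<open>(f + a) + b\<close>, leaving the exponent \<open>m + k - 1\<close> that is needed to split \<open>a\<close> off \<open>f + a\<close>.\<close>

lemma two_nilpotent_perturbations_power:
  fixes f a b :: "'r::{ring,monoid_mult}"
  assumes comm: "f * a = a * f" "f * b = b * f" "a * b = b * a"
    and nil: "a ^ k = 0" "b ^ l = 0" and pos: "k \<ge> 1" "l \<ge> 1"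
  shows "\<exists>w. (\<forall>h. h * f = f * h \<longrightarrow> h * a = a * h \<longrightarrow> h * b = b * h \<longrightarrow> h * w = w * h) \<and>
    (f + a + b) ^ (m + k + l - 2) = w * f ^ m"
proof -
  obtain v where v: "v \<in> bicommutant f a" "(f + a) ^ (m + k - 1) = v * f ^ m"
    using nilpotent_perturbation_power[OF comm(1) nil(1), of m "m + k - 1"] pos by auto
  have "(f + a) * b = b * (f + a)"
    by (simp add: distrib_left distrib_right comm)
  moreover have "m + k - 1 + l \<le> Suc (m + k + l - 2)" using pos by simp
  ultimately obtain u where u: "u \<in> bicommutant (f + a) b"
      "(f + a + b) ^ (m + k + l - 2) = u * (f + a) ^ (m + k - 1)"
    using nilpotent_perturbation_power nil(2) by blast
  have "h * (u * v) = u * v * h" if h: "h * f = f * h" "h * a = a * h" "h * b = b * h" for h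
  proof -
    have "h * (f + a) = (f + a) * h" by (simp add: distrib_left distrib_right h)
    then have "h * u = u * h" using u(1) h(3) bicommutantD by blast
    moreover have "h * v = v * h" using v(1) h bicommutantD by blast
    ultimately show ?thesis by (metis mult.assoc)
  qed
  then show ?thesis
    using u(2) v(2) by (intro exI[of _ "u * v"]) (simp add: mult.assoc)
qed

text \<open>The cofactor \<open>\<omega>\<close> of \<open>\<phi> ^ m\<close> commutes with the compression \<open>y \<mapsto> s' ^ n * y * s ^ n\<close>, so the
  compression can be carried out first, where it gives 0. The outer powers of \<open>s + c\<close> and
  \<open>s' + c'\<close> are multiples of \<open>s ^ n\<close> and \<open>s' ^ n\<close> on the appropriate sides.\<close>

lemma compressed_perturbation_eq_0:
  fixes s s' c c' x :: "'r::{ring,monoid_mult}" and \<phi> \<alpha> \<beta> :: "'r endo"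
  assumes comm: "\<phi> * \<alpha> = \<alpha> * \<phi>" "\<phi> * \<beta> = \<beta> * \<phi>" "\<alpha> * \<beta> = \<beta> * \<alpha>"
    and nil: "\<alpha> ^ k = 0" "\<beta> ^ l = 0" "c ^ k = 0" "c' ^ k = 0"
    and pos: "k \<ge> 1" "l \<ge> 1"
    and compression: "\<And>\<psi>. \<psi> \<in> {\<phi>, \<alpha>, \<beta>} \<Longrightarrow>
        lmult (s' ^ n) * rmult (s ^ n) * \<psi> = \<psi> * (lmult (s' ^ n) * rmult (s ^ n))"
    and sc: "s * c = c * s" "s' * c' = c' * s'"
    and zero: "s' ^ n * app (\<phi> ^ m) x * s ^ n = 0"
  shows "(s' + c') ^ (n + k - 1) * app ((\<phi> + \<alpha> + \<beta>) ^ (m + k + l - 2)) x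
    * (s + c) ^ (n + k - 1) = 0"
proof -
  define \<gamma> where "\<gamma> = lmult (s' ^ n) * rmult (s ^ n)"
  have app_\<gamma>: "app \<gamma> y = s' ^ n * y * s ^ n" for y
    by (simp add: \<gamma>_def times_endo.rep_eq lmult.rep_eq rmult.rep_eq mult.assoc)
  obtain \<omega> where \<omega>: "\<gamma> * \<omega> = \<omega> * \<gamma>" "(\<phi> + \<alpha> + \<beta>) ^ (m + k + l - 2) = \<omega> * \<phi> ^ m"
    using two_nilpotent_perturbations_power[OF comm nil(1,2) pos, of m]
      compression[folded \<gamma>_def] by blast
  define y where "y = app ((\<phi> + \<alpha> + \<beta>) ^ (m + k + l - 2)) x"
  have "s' ^ n * y * s ^ n = app (\<gamma> * \<omega>) (app (\<phi> ^ m) x)"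
    by (simp add: y_def app_\<gamma> \<omega>(2) times_endo.rep_eq)
  also have "\<dots> = app \<omega> (s' ^ n * app (\<phi> ^ m) x * s ^ n)"
    by (simp add: \<omega>(1) times_endo.rep_eq app_\<gamma>)
  finally have y: "s' ^ n * y * s ^ n = 0" using zero by simp
  obtain w where w: "w \<in> bicommutant s c" "(s + c) ^ (n + k - 1) = w * s ^ n"
    using nilpotent_perturbation_power[OF sc(1) nil(3), of n "n + k - 1"] pos by auto
  obtain w' where w': "(s' + c') ^ (n + k - 1) = w' * s' ^ n"
    using nilpotent_perturbation_power[OF sc(2) nil(4), of n "n + k - 1"] pos by auto
  have "s * w = w * s"
    by (rule bicommutantD[OF w(1) refl sc(1)])
  then have "w * s ^ n = s ^ n * w"
    by (rule power_commuting_commutes[symmetric])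
  then have "(s' + c') ^ (n + k - 1) * y * (s + c) ^ (n + k - 1) = w' * (s' ^ n * y * s ^ n) * w"
    by (simp only: w(2) w' mult.assoc)
  then show ?thesis by (simp only: y y_def[symmetric] mult_zero_left mult_zero_right)
qed

text \<open>The perturbed superoperator splits as
  \<open>(t + b) x (s + c) - x = (t x s - x) + t x c + b x (s + c)\<close>. Grouping the last two terms
  this way leaves each perturbation with a single nilpotent factor.\<close>

lemma triangle_perturbation:
  fixes s s' t c c' b :: "'r::{ring,monoid_mult}"
  assumes "c ^ k = 0" "c' ^ k = 0" "b ^ l = 0" and pos: "k \<ge> 1" "l \<ge> 1"
    and comm: "s * c = c * s" "s' * c' = c' * s'" "b * t = t * b" "s' * t = t * s'" "s' * b = b * s'"
    and zero: "s' ^ n * app ((lmult t * rmult s - 1) ^ m) x * s ^ n = 0"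
  shows "(s' + c') ^ (n + k - 1) * app ((lmult (t + b) * rmult (s + c) - 1) ^ (m + k + l - 2)) x
    * (s + c) ^ (n + k - 1) = 0"
proof -
  let ?\<phi> = "lmult t * rmult s - 1" and ?\<alpha> = "lmult t * rmult c"
    and ?\<beta> = "lmult b * rmult (s + c)"
  have decomp: "lmult (t + b) * rmult (s + c) - 1 = ?\<phi> + ?\<alpha> + ?\<beta>"
    by (simp add: lmult_add rmult_add algebra_simps)
  have powers: "s' ^ n * t = t * s' ^ n" "s' ^ n * b = b * s' ^ n"
    "c * s ^ n = s ^ n * c" "s * s ^ n = s ^ n * s"
    using comm by (simp_all add: power_commuting_commutes power_commutes)
  show ?thesis
    unfolding decomp
  proof (rule compressed_perturbation_eq_0[OF _ _ _ _ _ assms(1,2) pos _ comm(1,2) zero])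
    show "?\<phi> * ?\<alpha> = ?\<alpha> * ?\<phi>" "?\<phi> * ?\<beta> = ?\<beta> * ?\<phi>" "?\<alpha> * ?\<beta> = ?\<beta> * ?\<alpha>"
      using comm by (simp_all add: left_diff_distrib right_diff_distrib two_sided_mult
          distrib_left distrib_right)
    show "?\<alpha> ^ k = 0" "?\<beta> ^ l = 0"
      by (simp_all add: two_sided_power assms)
    show "lmult (s' ^ n) * rmult (s ^ n) * \<psi> = \<psi> * (lmult (s' ^ n) * rmult (s ^ n))"
      if "\<psi> \<in> {?\<phi>, ?\<alpha>, ?\<beta>}" for \<psi>
      using that by (elim insertE emptyE; simp only: left_diff_distrib right_diff_distrib
          two_sided_mult distrib_left distrib_right mult_1_left mult_1_right powers)
  qed
qed

lemma delta_perturbation: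
  fixes s s' t c c' b :: "'r::{ring,monoid_mult}"
  assumes "c ^ k = 0" "c' ^ k = 0" "b ^ l = 0" and pos: "k \<ge> 1" "l \<ge> 1"
    and comm: "s * c = c * s" "s' * c' = c' * s'" "b * t = t * b" "s' * t = t * s'" "s' * b = b * s'"
    and zero: "s' ^ n * app ((lmult t - rmult s) ^ m) x * s ^ n = 0"
  shows "(s' + c') ^ (n + k - 1) * app ((lmult (t + b) - rmult (s + c)) ^ (m + k + l - 2)) x
    * (s + c) ^ (n + k - 1) = 0"
proof -
  let ?\<phi> = "lmult t - rmult s"
  have decomp: "lmult (t + b) - rmult (s + c) = ?\<phi> + rmult (- c) + lmult b"
    by (simp only: lmult_add rmult_add rmult_uminus diff_conv_add_uminus minus_add_distrib ac_simps)
  have left: "lmult u * rmult v * lmult w = lmult (u * w) * rmult v"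
    "lmult w * (lmult u * rmult v) = lmult (w * u) * rmult v"
    "lmult u * rmult v * rmult w = lmult u * rmult (w * v)"
    "rmult w * (lmult u * rmult v) = lmult u * rmult (v * w)" for u v w :: 'r
    using two_sided_mult[of u v w 1] two_sided_mult[of w 1 u v]
      two_sided_mult[of u v 1 w] two_sided_mult[of 1 w u v]
    by (simp_all only: lmult_1 rmult_1 mult_1_left mult_1_right)
  have powers: "s' ^ n * t = t * s' ^ n" "s' ^ n * b = b * s' ^ n"
    "c * s ^ n = s ^ n * c" "s * s ^ n = s ^ n * s"
    using comm by (simp_all add: power_commuting_commutes power_commutes)
  show ?thesis
    unfolding decomp
  proof (rule compressed_perturbation_eq_0[OF _ _ _ _ _ assms(1,2) pos _ comm(1,2) zero])
    show "?\<phi> * rmult (- c) = rmult (- c) * ?\<phi>" "?\<phi> * lmult b = lmult b * ?\<phi>"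
      "rmult (- c) * lmult b = lmult b * rmult (- c)"
      using comm by (simp_all add: left_diff_distrib right_diff_distrib lmult_rmult_commute
          lmult_mult rmult_mult)
    show "rmult (- c) ^ k = 0" "lmult b ^ l = 0"
      by (simp_all only: rmult_power lmult_power uminus_power_eq_0[OF assms(1)] assms(3)
          rmult_0 lmult_0)
    show "lmult (s' ^ n) * rmult (s ^ n) * \<psi> = \<psi> * (lmult (s' ^ n) * rmult (s ^ n))"
      if "\<psi> \<in> {?\<phi>, rmult (- c), lmult b}" for \<psi>
      using that by (elim insertE emptyE; simp only: left_diff_distrib right_diff_distrib
          left mult_minus_left mult_minus_right powers)
  qed
qed

section \<open>The binomial sums as powers of superoperators\<close>

text \<open>With a free doubly indexed summand, the two families of binomial sums become instances of one
  iterated difference, and Pascal's rule has to be used only once.\<close>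

definition alternating_sum :: "nat \<Rightarrow> (nat \<Rightarrow> nat \<Rightarrow> 'a) \<Rightarrow> 'a::complex_inner" where
  "alternating_sum m c = (\<Sum>j=0..m. ((-1) ^ j * of_nat (m choose j)) *\<^sub>C c (m - j) j)"

lemma alternating_sum_Suc:
  "alternating_sum (Suc m) c =
    alternating_sum m (\<lambda>i j. c (Suc i) j) - alternating_sum m (\<lambda>i j. c i (Suc j))"
proof -
  let ?b = "\<lambda>k j. (-1) ^ j * of_nat (k choose j) :: complex"
  have Suc: "?b (Suc m) (Suc j) = ?b m (Suc j) - ?b m j" for j
    by (simp add: algebra_simps)
  have "alternating_sum (Suc m) c = ?b (Suc m) 0 *\<^sub>C c (Suc m) 0 +
      (\<Sum>j=0..m. ?b (Suc m) (Suc j) *\<^sub>C c (m - j) (Suc j))"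
    unfolding alternating_sum_def by (subst sum.atLeast0_atMost_Suc_shift) simp
  also have "\<dots> = (c (Suc m) 0 + (\<Sum>j=0..m. ?b m (Suc j) *\<^sub>C c (m - j) (Suc j)))
      - alternating_sum m (\<lambda>i j. c i (Suc j))"
    unfolding Suc alternating_sum_def
    by (simp add: complex_vector.scale_left_diff_distrib sum_subtractf)
  also have "c (Suc m) 0 + (\<Sum>j=0..m. ?b m (Suc j) *\<^sub>C c (m - j) (Suc j)) =
      (\<Sum>j=0..Suc m. ?b m j *\<^sub>C c (Suc m - j) j)"
    by (subst sum.atLeast0_atMost_Suc_shift) simp
  also have "\<dots> = (\<Sum>j=0..m. ?b m j *\<^sub>C c (Suc m - j) j)"
    by simp
  also have "\<dots> = alternating_sum m (\<lambda>i j. c (Suc i) j)"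
    unfolding alternating_sum_def by (intro sum.cong refl) (simp add: Suc_diff_le)
  finally show ?thesis .
qed

lemma alternating_sum_clinear:
  assumes "bounded_clinear A"
  shows "A (alternating_sum m c) = alternating_sum m (\<lambda>i j. A (c i j))"
proof -
  interpret A: bounded_linear A using assms by (simp add: bounded_clinear_def)
  show ?thesis
    using assms by (simp add: alternating_sum_def A.sum bounded_clinear_def)
qed

lemma triangle_op_alternating_sum:
  "triangle_op m T S x = alternating_sum m (\<lambda>i j. (T ^^ i) ((S ^^ i) x))"
  by (simp add: triangle_op_def alternating_sum_def)

lemma delta_op_alternating_sum:
  "delta_op m T S x = alternating_sum m (\<lambda>i j. (T ^^ i) ((S ^^ j) x))"
  by (simp add: delta_op_def alternating_sum_def)

text \<open>Pascal's rule turns the binomial sum of order \<open>m + 1\<close> into one application of the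
  superoperator to the sum of order \<open>m\<close>. The left operator is pulled out of a sum with complex
  coefficients, hence the linearity assumption on \<open>t\<close> beyond its additivity.\<close>

lemma triangle_op_eq_power:
  assumes "bounded_clinear (app t)"
  shows "triangle_op m (app t) (app s) = app (app ((lmult t * rmult s - 1) ^ m) 1)"
proof (induction m)
  case 0
  show ?case by (auto simp: fun_eq_iff triangle_op_def one_endo.rep_eq)
next
  case (Suc m)
  have "triangle_op (Suc m) (app t) (app s) x =
      app t (triangle_op m (app t) (app s) (app s x)) - triangle_op m (app t) (app s) x" for x
    unfolding triangle_op_alternating_sum alternating_sum_Suc alternating_sum_clinear[OF assms]
    by (simp add: funpow_swap1)
  then show ?case
    by (simp add: Suc fun_eq_iff times_endo.rep_eq minus_endo.rep_eq one_endo.rep_eq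
        lmult.rep_eq rmult.rep_eq)
qed

lemma delta_op_eq_power:
  assumes "bounded_clinear (app t)"
  shows "delta_op m (app t) (app s) = app (app ((lmult t - rmult s) ^ m) 1)"
proof (induction m)
  case 0
  show ?case by (auto simp: fun_eq_iff delta_op_def one_endo.rep_eq)
next
  case (Suc m)
  have "delta_op (Suc m) (app t) (app s) x =
      app t (delta_op m (app t) (app s) x) - delta_op m (app t) (app s) (app s x)" for x
    unfolding delta_op_alternating_sum alternating_sum_Suc alternating_sum_clinear[OF assms]
    by (simp add: funpow_swap1)
  then show ?case
    by (simp add: Suc fun_eq_iff times_endo.rep_eq minus_endo.rep_eq
        lmult.rep_eq rmult.rep_eq)
qed

lemma bounded_clinear_add:
  "bounded_clinear A \<Longrightarrow> bounded_clinear B \<Longrightarrow> bounded_clinear (\<lambda>x. A x + B x)"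
  by (auto simp: bounded_clinear_def bounded_linear_add scaleC_add_right)

lemma bounded_clinear_additive: "bounded_clinear A \<Longrightarrow> Modules.additive A"
  by (simp add: bounded_clinear_def Modules.additive_def bounded_linear.linear linear_add)

theorem theorem5p3:
  fixes S T N1 N2 :: "'a::chilbert_space \<Rightarrow> 'a"
    and d :: "nat \<Rightarrow> ('a \<Rightarrow> 'a) \<Rightarrow> ('a \<Rightarrow> 'a) \<Rightarrow> 'a \<Rightarrow> 'a"
    and m n n1 n2 :: nat
  assumes infinite_dim: "\<nexists>B :: 'a set. finite B \<and> complex_vector.span B = UNIV"
    and d: "d \<in> {triangle_op, delta_op}"
    and "m \<ge> 1" "n \<ge> 1" "n1 \<ge> 1" "n2 \<ge> 1"
    and "bounded_clinear S" "bounded_clinear T" "bounded_clinear N1" "bounded_clinear N2"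
    and "(cadjoint S ^^ n) \<circ> d m T S \<circ> (S ^^ n) = (\<lambda>x. 0)"
    and "N1 ^^ n1 = (\<lambda>x. 0)" "N2 ^^ n2 = (\<lambda>x. 0)"
    and "S \<circ> N1 = N1 \<circ> S"
    and "S \<circ> cadjoint T = cadjoint T \<circ> S"
    and "N2 \<circ> T = T \<circ> N2"
    and "cadjoint N2 \<circ> S = S \<circ> cadjoint N2"
  shows "((\<lambda>x. cadjoint S x + cadjoint N1 x) ^^ (n + n1 - 1))
      \<circ> d (m + n1 + n2 - 2) (\<lambda>x. T x + N2 x) (\<lambda>x. S x + N1 x)
      \<circ> ((\<lambda>x. S x + N1 x) ^^ (n + n1 - 1)) = (\<lambda>x. 0)"
proof -
  note bounded = assms(7-10) and zero = assms(11) and nil = assms(12,13)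
  define s t c b s' c' where defs: "s = Endo S" "t = Endo T" "c = Endo N1" "b = Endo N2"
    "s' = Endo (cadjoint S)" "c' = Endo (cadjoint N1)"
  have adj: "adjoint_pair S (cadjoint S)" "adjoint_pair T (cadjoint T)"
    "adjoint_pair N1 (cadjoint N1)" "adjoint_pair N2 (cadjoint N2)"
    using bounded by (simp_all add: adjoint_pair_cadjoint)
  have app: "app s = S" "app t = T" "app c = N1" "app b = N2"
    "app s' = cadjoint S" "app c' = cadjoint N1"
    unfolding defs using bounded adj
    by (simp_all add: Endo_inverse bounded_clinear_additive adjoint_pair_additive)
  have eqI: "f = g" if "app f = app g" for f g :: "'a endo"
    using that by (simp add: app_inject)
  have nil': "c ^ n1 = 0" "c' ^ n1 = 0" "b ^ n2 = 0"
    using nil adjoint_pair_nilpotent[OF adj(3) nil(1)]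
    by (auto intro!: eqI simp: app_power app zero_endo.rep_eq)
  \<comment> \<open>The relations of \<open>s'\<close> with \<open>t\<close> and \<open>b\<close> are the adjoints of the hypotheses on \<open>S\<close> with
    \<open>T\<^sup>*\<close> and \<open>N\<^sub>2\<^sup>*\<close>, read with \<open>T\<close> and \<open>N\<^sub>2\<close> as the adjoints of their adjoints.\<close>
  have comm: "s * c = c * s" "s' * c' = c' * s'" "b * t = t * b" "s' * t = t * s'" "s' * b = b * s'"
    using assms(14,16) adjoint_pair_commuting[OF adj(1,3) assms(14)]
      adjoint_pair_commuting[OF adj(1) adjoint_pair_commute[OF adj(2)] assms(15)]
      adjoint_pair_commuting[OF adj(1) adjoint_pair_commute[OF adj(4)] assms(17)[symmetric]]
    by (auto intro!: eqI simp: times_endo.rep_eq app)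
  have sums: "app (t + b) = (\<lambda>x. T x + N2 x)" "app (s + c) = (\<lambda>x. S x + N1 x)"
    "app (s' + c') = (\<lambda>x. cadjoint S x + cadjoint N1 x)"
    by (simp_all add: plus_endo.rep_eq app)
  have clin: "bounded_clinear (app t)" "bounded_clinear (app (t + b))"
    using bounded by (simp_all add: app sums bounded_clinear_add)
  have "\<exists>y. app y = d (m + n1 + n2 - 2) (app (t + b)) (app (s + c)) \<and>
      (s' + c') ^ (n + n1 - 1) * y * (s + c) ^ (n + n1 - 1) = 0"
  proof (cases "d = triangle_op")
    case True
    have "s' ^ n * app ((lmult t * rmult s - 1) ^ m) 1 * s ^ n = 0"
      using zero unfolding True
      by (intro eqI) (simp only: times_endo.rep_eq app_power[of s'] app_power[of s]
          zero_endo.rep_eq app triangle_op_eq_power[OF clin(1), of m s, unfolded app, symmetric])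
    from triangle_perturbation[OF nil' assms(5,6) comm this] show ?thesis
      using triangle_op_eq_power[OF clin(2)] True by metis
  next
    case False
    then have d: "d = delta_op" using d by simp
    have "s' ^ n * app ((lmult t - rmult s) ^ m) 1 * s ^ n = 0"
      using zero unfolding d
      by (intro eqI) (simp only: times_endo.rep_eq app_power[of s'] app_power[of s]
          zero_endo.rep_eq app delta_op_eq_power[OF clin(1), of m s, unfolded app, symmetric])
    from delta_perturbation[OF nil' assms(5,6) comm this] show ?thesis
      using delta_op_eq_power[OF clin(2)] d by metis
  qed
  then obtain y where y: "app y = d (m + n1 + n2 - 2) (app (t + b)) (app (s + c))"
    "(s' + c') ^ (n + n1 - 1) * y * (s + c) ^ (n + n1 - 1) = 0" by blast
  have "app ((s' + c') ^ (n + n1 - 1) * y * (s + c) ^ (n + n1 - 1)) = (\<lambda>x. 0)"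
    unfolding y(2) by (rule zero_endo.rep_eq)
  then show ?thesis
    unfolding times_endo.rep_eq app_power y(1) sums .
qed

end
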